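(* Let $G$ be a graph containing a twin class of size $t$, and let $v$ be one of these $t$ twins. Then $W(G,G-v)\ge t$.
   Context: Graphs are finite and simple. For three pairwise distinct vertices $u,v,w$, $w$ separates $u$ and $v$ if $w$ is adjacent to exactly one of them. Vertices $u,v$ are twins if $u=v$ or no vertex separates them (equivalently, the transposition $(uv)$ is an automorphism). Being twins is an equivalence relation; its classes are twin classes. $G-v$ is the graph obtained from $G$ by deleting the vertex $v$. For non-isomorphic graphs $G,H$, $W(G,H)$ is the minimum number of distinct variables in a first-order sentence over the vocabulary $\{\sim,=\}$ (adjacency and equality) that is true on one of $G,H$ and false on the other. *)

theory Defs
  imports "Graph_Theory.Digraph"
begin

(* Finite simple graphs are modelled by the locale predicate graph of Graph_Theory.Digraph:
   finite, loop-free, symmetric digraphs without parallel arcs. *)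

definition separates :: "('a, 'b) pre_digraph \<Rightarrow> 'a \<Rightarrow> 'a \<Rightarrow> 'a \<Rightarrow> bool" where
  "separates G w u v \<longleftrightarrow>
     u \<in> verts G \<and> v \<in> verts G \<and> w \<in> verts G \<and> u \<noteq> v \<and> u \<noteq> w \<and> v \<noteq> w \<and>
     (w \<rightarrow>\<^bsub>G\<^esub> u) \<noteq> (w \<rightarrow>\<^bsub>G\<^esub> v)"

definition twin_rel :: "('a, 'b) pre_digraph \<Rightarrow> 'a rel" where
  "twin_rel G =
     {(u, v). u \<in> verts G \<and> v \<in> verts G \<and> (u = v \<or> \<not> (\<exists>w. separates G w u v))}"

definition twin_classes :: "('a, 'b) pre_digraph \<Rightarrow> 'a set set" where
  "twin_classes G = verts G // twin_rel G"

lemma equiv_twin_rel: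
  assumes "graph G"
  shows "equiv (verts G) (twin_rel G)"
proof -
  interpret graph G by fact
  have sym_adj: "(x \<rightarrow>\<^bsub>G\<^esub> y) = (y \<rightarrow>\<^bsub>G\<^esub> x)" for x y
    using sym_arcs by (auto simp: symmetric_def dest: symD)
  have twinD: "(w \<rightarrow>\<^bsub>G\<^esub> u) = (w \<rightarrow>\<^bsub>G\<^esub> v)"
    if "(u, v) \<in> twin_rel G" "w \<in> verts G" "w \<noteq> u" "w \<noteq> v" for u v w
    using that by (auto simp: twin_rel_def separates_def)
  show ?thesis
  proof (rule equivI)
    show "twin_rel G \<subseteq> verts G \<times> verts G"
      by (auto simp: twin_rel_def)
    show "refl_on (verts G) (twin_rel G)"
      by (auto simp: refl_on_def twin_rel_def)
    show "sym (twin_rel G)"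
      by (auto simp: sym_def twin_rel_def separates_def)
    show "trans (twin_rel G)"
    proof (rule transI)
      fix x y z
      assume xy: "(x, y) \<in> twin_rel G" and yz: "(y, z) \<in> twin_rel G"
      then have V: "x \<in> verts G" "y \<in> verts G" "z \<in> verts G"
        by (auto simp: twin_rel_def)
      have "\<not> separates G w x z" for w
      proof
        assume s: "separates G w x z"
        then have w: "w \<in> verts G" "w \<noteq> x" "w \<noteq> z" "x \<noteq> z"
          and ne: "(w \<rightarrow>\<^bsub>G\<^esub> x) \<noteq> (w \<rightarrow>\<^bsub>G\<^esub> z)"
          by (auto simp: separates_def)
        show False
        proof (cases "w = y")
          case True
          have "(z \<rightarrow>\<^bsub>G\<^esub> x) = (z \<rightarrow>\<^bsub>G\<^esub> y)"
            using twinD[OF xy, of z] V w True by auto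
          moreover have "(x \<rightarrow>\<^bsub>G\<^esub> y) = (x \<rightarrow>\<^bsub>G\<^esub> z)"
            using twinD[OF yz, of x] V w True by auto
          ultimately show False
            using ne True sym_adj by metis
        next
          case False
          then show False
            using twinD[OF xy, of w] twinD[OF yz, of w] w ne by auto
        qed
      qed
      then show "(x, z) \<in> twin_rel G"
        using V by (auto simp: twin_rel_def)
    qed
  qed
qed

datatype fo =
    Eq nat nat
  | Adj nat nat
  | Neg fo
  | Conj fo fo
  | Disj fo fo
  | Imp fo fo
  | Ex nat fo
  | All nat fo

(* All variables, bound ones included; a variable that is re-quantified counts once. *)
primrec vars :: "fo \<Rightarrow> nat set" where
  "vars (Eq x y) = {x, y}"
| "vars (Adj x y) = {x, y}"
| "vars (Neg \<phi>) = vars \<phi>"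
| "vars (Conj \<phi> \<psi>) = vars \<phi> \<union> vars \<psi>"
| "vars (Disj \<phi> \<psi>) = vars \<phi> \<union> vars \<psi>"
| "vars (Imp \<phi> \<psi>) = vars \<phi> \<union> vars \<psi>"
| "vars (Ex x \<phi>) = insert x (vars \<phi>)"
| "vars (All x \<phi>) = insert x (vars \<phi>)"

primrec free_vars :: "fo \<Rightarrow> nat set" where
  "free_vars (Eq x y) = {x, y}"
| "free_vars (Adj x y) = {x, y}"
| "free_vars (Neg \<phi>) = free_vars \<phi>"
| "free_vars (Conj \<phi> \<psi>) = free_vars \<phi> \<union> free_vars \<psi>"
| "free_vars (Disj \<phi> \<psi>) = free_vars \<phi> \<union> free_vars \<psi>"
| "free_vars (Imp \<phi> \<psi>) = free_vars \<phi> \<union> free_vars \<psi>"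
| "free_vars (Ex x \<phi>) = free_vars \<phi> - {x}"
| "free_vars (All x \<phi>) = free_vars \<phi> - {x}"

definition sentence :: "fo \<Rightarrow> bool" where
  "sentence \<phi> \<longleftrightarrow> free_vars \<phi> = {}"

primrec sat :: "('a, 'b) pre_digraph \<Rightarrow> (nat \<Rightarrow> 'a) \<Rightarrow> fo \<Rightarrow> bool" where
  "sat G s (Eq x y) \<longleftrightarrow> s x = s y"
| "sat G s (Adj x y) \<longleftrightarrow> s x \<rightarrow>\<^bsub>G\<^esub> s y"
| "sat G s (Neg \<phi>) \<longleftrightarrow> \<not> sat G s \<phi>"
| "sat G s (Conj \<phi> \<psi>) \<longleftrightarrow> sat G s \<phi> \<and> sat G s \<psi>"
| "sat G s (Disj \<phi> \<psi>) \<longleftrightarrow> sat G s \<phi> \<or> sat G s \<psi>"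
| "sat G s (Imp \<phi> \<psi>) \<longleftrightarrow> (sat G s \<phi> \<longrightarrow> sat G s \<psi>)"
| "sat G s (Ex x \<phi>) \<longleftrightarrow> (\<exists>a\<in>verts G. sat G (s(x := a)) \<phi>)"
| "sat G s (All x \<phi>) \<longleftrightarrow> (\<forall>a\<in>verts G. sat G (s(x := a)) \<phi>)"

(* Assignments range over the whole type, so that this also makes sense for the graph
   without vertices; for a sentence the choice of s is irrelevant, see models_iff. *)
definition models :: "('a, 'b) pre_digraph \<Rightarrow> fo \<Rightarrow> bool" where
  "models G \<phi> \<longleftrightarrow> (\<forall>s. sat G s \<phi>)"

lemma sat_cong:
  assumes "\<And>x. x \<in> free_vars \<phi> \<Longrightarrow> s x = s' x"
  shows "sat G s \<phi> = sat G s' \<phi>"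
  using assms
proof (induction \<phi> arbitrary: s s')
  case (Ex x \<phi>)
  have "sat G (s(x := a)) \<phi> = sat G (s'(x := a)) \<phi>" for a
    using Ex.prems by (intro Ex.IH) auto
  then show ?case by simp
next
  case (All x \<phi>)
  have "sat G (s(x := a)) \<phi> = sat G (s'(x := a)) \<phi>" for a
    using All.prems by (intro All.IH) auto
  then show ?case by simp
next
  case (Neg \<phi>)
  have "sat G s \<phi> = sat G s' \<phi>"
    using Neg.prems by (intro Neg.IH) auto
  then show ?case by simp
next
  case (Conj \<phi> \<psi>)
  have "sat G s \<phi> = sat G s' \<phi>" "sat G s \<psi> = sat G s' \<psi>"
    using Conj.prems by (auto intro!: Conj.IH)
  then show ?case by simp
next
  case (Disj \<phi> \<psi>)
  have "sat G s \<phi> = sat G s' \<phi>" "sat G s \<psi> = sat G s' \<psi>"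
    using Disj.prems by (auto intro!: Disj.IH)
  then show ?case by simp
next
  case (Imp \<phi> \<psi>)
  have "sat G s \<phi> = sat G s' \<phi>" "sat G s \<psi> = sat G s' \<psi>"
    using Imp.prems by (auto intro!: Imp.IH)
  then show ?case by simp
qed auto

lemma models_iff:
  assumes "sentence \<phi>"
  shows "models G \<phi> \<longleftrightarrow> sat G s \<phi>"
  using assms sat_cong[of \<phi>] unfolding models_def sentence_def by blast

definition distinguishes :: "fo \<Rightarrow> ('a, 'b) pre_digraph \<Rightarrow> ('c, 'd) pre_digraph \<Rightarrow> bool" where
  "distinguishes \<phi> G H \<longleftrightarrow> sentence \<phi> \<and> models G \<phi> \<noteq> models H \<phi>"

(* Only meaningful if some sentence distinguishes G and H, i.e. for finite graphs if they are
   not isomorphic; otherwise LEAST yields an unspecified number. *)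
definition W :: "('a, 'b) pre_digraph \<Rightarrow> ('c, 'd) pre_digraph \<Rightarrow> nat" where
  "W G H = (LEAST n. \<exists>\<phi>. distinguishes \<phi> G H \<and> card (vars \<phi>) = n)"

end

theory Submission
  imports Defs
begin

text \<open>
  Twins are indistinguishable to their neighbourhood, so a vertex outside \<open>T\<close> is matched with
  itself and any injection between vertices of \<open>T\<close> preserves adjacency. With \<open>k < t\<close> variables, at
  most \<open>k - 1 < t - 1\<close> vertices of \<open>T\<close> are still referred to when a variable is re-quantified, so in
  both \<open>G\<close> and \<open>G - v\<close> an unused vertex of \<open>T\<close> remains: Duplicator wins the \<open>k\<close>-pebble game. Since
  the two graphs differ in order, some sentence does distinguish them, so that \<open>W\<close> is a genuine
  minimum.
\<close>

section \<open>Counting vertices by first-order sentences\<close>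

text \<open>The tautology \<open>Eq x x\<close> stands for the empty conjunction, as the syntax has
  no truth constant.\<close>

primrec differs_below :: "nat \<Rightarrow> nat \<Rightarrow> fo" where
  "differs_below x 0 = Eq x x"
| "differs_below x (Suc k) = Conj (Neg (Eq k x)) (differs_below x k)"

lemma sat_differs_below: "sat G s (differs_below x k) \<longleftrightarrow> (\<forall>i<k. s i \<noteq> s x)"
  by (induction k) (auto simp: less_Suc_eq)

lemma free_vars_differs_below: "free_vars (differs_below x k) = insert x {..<k}"
  by (induction k) (simp_all add: lessThan_Suc insert_commute)

text \<open>The sentence for \<open>n = 0\<close> is universal so that it also holds in the graph without vertices.\<close>


fun has_more :: "nat \<Rightarrow> nat \<Rightarrow> fo" where
  "has_more i 0 = All i (Eq i i)"
| "has_more i (Suc n) = Ex i (Conj (differs_below i i) (has_more (Suc i) n))"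

lemma free_vars_has_more: "free_vars (has_more i n) \<subseteq> {..<i}"
  by (induction i n rule: has_more.induct) (auto simp: free_vars_differs_below less_Suc_eq)

text \<open>Each quantifier picks a vertex that is not yet the value of a variable below
  \<open>i\<close>, so the set of vertices still available loses exactly one element. Finiteness
  matters because \<open>card\<close> is 0 on infinite sets.\<close>

lemma sat_has_more:
  assumes "finite (verts G)"
  shows "sat G s (has_more i n) \<longleftrightarrow> n \<le> card (verts G - s ` {..<i})"
proof (induction i n arbitrary: s rule: has_more.induct)
  case (2 i n)
  let ?R = "verts G - s ` {..<i}"
  have img: "(s(i := a)) ` {..<Suc i} = insert a (s ` {..<i})" for a
    by (auto simp: lessThan_Suc)
  have new: "(\<forall>j<i. (s(i := a)) j \<noteq> (s(i := a)) i) \<longleftrightarrow> a \<notin> s ` {..<i}" for a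
    by auto
  have diff: "verts G - insert a (s ` {..<i}) = ?R - {a}" for a
    by blast
  have "sat G s (has_more i (Suc n)) \<longleftrightarrow> (\<exists>a\<in>?R. n \<le> card (?R - {a}))"
    unfolding has_more.simps sat.simps 2 img diff sat_differs_below new by blast
  also have "\<dots> \<longleftrightarrow> (\<exists>a\<in>?R. Suc n \<le> card ?R)"
  proof (intro bex_cong refl)
    fix a assume "a \<in> ?R"
    then have "card ?R = Suc (card (?R - {a}))"
      using assms by (intro card.remove) auto
    then show "n \<le> card (?R - {a}) \<longleftrightarrow> Suc n \<le> card ?R" by simp
  qed
  also have "\<dots> \<longleftrightarrow> Suc n \<le> card ?R"
    \<comment> \<open>A positive cardinality already supplies the witness \<open>a\<close>.\<close>
    by (metis Suc_le_D card.empty ex_in_conv nat.distinct(1))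
  finally show ?case .
qed simp

lemma distinguishes_if_card_verts_less:
  assumes "finite (verts G)" "finite (verts H)" "card (verts H) < card (verts G)"
  shows "\<exists>\<phi>. distinguishes \<phi> G H"
proof -
  let ?\<phi> = "has_more 0 (card (verts G))"
  have sent: "sentence ?\<phi>"
    using free_vars_has_more[of 0] by (auto simp: sentence_def)
  have "models G ?\<phi>" "\<not> models H ?\<phi>"
    using assms by (auto simp: models_def sat_has_more)
  with sent show ?thesis by (auto simp: distinguishes_def)
qed

section \<open>The pebble game as a back-and-forth argument\<close>

text \<open>Duplicator's invariant, with \<open>D\<close> the variables currently in play: a partial
  bijection from \<open>A\<close> to \<open>B\<close> that respects \<open>T\<close> and is the
  identity outside \<open>T\<close>. Adjacency is left out, since for twins it follows.\<close>

definition matched :: "'a set \<Rightarrow> 'a set \<Rightarrow> 'a set \<Rightarrow> nat set \<Rightarrow> (nat \<Rightarrow> 'a) \<Rightarrow> (nat \<Rightarrow> 'a) \<Rightarrow> bool" where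
  "matched T A B D s s' \<longleftrightarrow>
     (\<forall>x\<in>D. s x \<in> A \<and> s' x \<in> B \<and> (s x \<in> T \<longleftrightarrow> s' x \<in> T) \<and> (s x \<notin> T \<longrightarrow> s' x = s x)) \<and>
     (\<forall>x\<in>D. \<forall>y\<in>D. s x = s y \<longleftrightarrow> s' x = s' y)"

lemma matched_sym: "matched T A B D s s' \<longleftrightarrow> matched T B A D s' s"
  unfolding matched_def
  by (rule arg_cong2[where f = "(\<and>)"]; intro ball_cong refl) (auto simp: eq_commute)

lemma matched_mono: "matched T A B D s s' \<Longrightarrow> D' \<subseteq> D \<Longrightarrow> matched T A B D' s s'"
  unfolding matched_def by blast

text \<open>One round of the game. The old value of \<open>x\<close> is released before Duplicator
  answers, so only the variables in \<open>D - {x}\<close> can block vertices of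
  \<open>B \<inter> T\<close>.\<close>

lemma matched_extend:
  assumes m: "matched T A B (D - {x}) s s'"
    and sub: "A - T \<subseteq> B"
    and fin: "finite D"
    and card: "card (D - {x}) < card (B \<inter> T)"
    and a: "a \<in> A"
  shows "\<exists>b\<in>B. matched T A B D (s(x := a)) (s'(x := b))"
proof -
  let ?D = "D - {x}"
  have m1: "s y \<in> A \<and> s' y \<in> B \<and> (s y \<in> T \<longleftrightarrow> s' y \<in> T) \<and> (s y \<notin> T \<longrightarrow> s' y = s y)"
    if "y \<in> ?D" for y
    using m that unfolding matched_def by blast
  have m2: "s y = s z \<longleftrightarrow> s' y = s' z" if "y \<in> ?D" "z \<in> ?D" for y z
    using m that unfolding matched_def by blast
  have ext: ?thesis
    if b: "b \<in> B" "a \<in> T \<longleftrightarrow> b \<in> T" "a \<notin> T \<longrightarrow> b = a"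
      and new: "\<And>y. y \<in> ?D \<Longrightarrow> a = s y \<longleftrightarrow> b = s' y" for b
  proof -
    have "matched T A B D (s(x := a)) (s'(x := b))"
      unfolding matched_def
    proof (intro conjI ballI)
      fix y z assume yz: "y \<in> D" "z \<in> D"
      show "((s(x := a)) y = (s(x := a)) z) = ((s'(x := b)) y = (s'(x := b)) z)"
        using m2[of y z] new[of y] new[of z] yz by (cases "y = x"; cases "z = x") auto
    next
      fix y assume "y \<in> D"
      then have "y = x \<or> y \<in> ?D" by blast
      then show "(s(x := a)) y \<in> A" "(s'(x := b)) y \<in> B"
        "(s(x := a)) y \<in> T \<longleftrightarrow> (s'(x := b)) y \<in> T"
        "(s(x := a)) y \<notin> T \<longrightarrow> (s'(x := b)) y = (s(x := a)) y"
        using m1[of y] a b by auto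
    qed
    with b(1) show ?thesis by blast
  qed
  consider "a \<notin> T" | y where "a \<in> T" "y \<in> ?D" "a = s y" | "a \<in> T" "a \<notin> s ` ?D"
    by blast
  then show ?thesis
  proof cases
    case 1
    have "a = s y \<longleftrightarrow> a = s' y" if "y \<in> ?D" for y
      using m1[OF that] 1 by auto
    with 1 a sub show ?thesis
      by (intro ext[of a]) auto
  next
    case 2
    then show ?thesis
      using m1[of y] m2[of y] by (intro ext[of "s' y"]) auto
  next
    case 3
    \<comment> \<open>Pigeonhole: the variables in play take too few values to cover
      \<open>B \<inter> T\<close>.\<close>
    have "\<not> B \<inter> T \<subseteq> s' ` ?D"
      using card card_image_le[of ?D s'] card_mono[of "s' ` ?D" "B \<inter> T"] fin by force
    then obtain b where "b \<in> B" "b \<in> T" "b \<notin> s' ` ?D" by blast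
    then show ?thesis
      using 3 by (intro ext[of b]) auto
  qed
qed

text \<open>Induction on the formula: equality atoms are preserved by the invariant, adjacency atoms
  by \<open>adj\<close>, and each quantifier is one round of the game.\<close>

lemma sat_iff_if_matched:
  assumes X: "finite X" "card X \<le> card (verts G \<inter> T)" "card X \<le> card (verts H \<inter> T)"
    and out: "verts G - T = verts H - T"
    and adj: "\<And>s s' x y. matched T (verts G) (verts H) {x, y} s s' \<Longrightarrow>
      (s x \<rightarrow>\<^bsub>G\<^esub> s y) = (s' x \<rightarrow>\<^bsub>H\<^esub> s' y)"
    and "vars \<phi> \<subseteq> X"
    and "matched T (verts G) (verts H) (free_vars \<phi>) s s'"
  shows "sat G s \<phi> = sat H s' \<phi>"
proof -
  have free_sub: "free_vars \<psi> \<subseteq> vars \<psi>" for \<psi>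
    by (induction \<psi>) auto
  have step:
    "(\<forall>a\<in>verts G. \<exists>b\<in>verts H. matched T (verts G) (verts H) (free_vars \<psi>) (s(x := a)) (s'(x := b))) \<and>
     (\<forall>b\<in>verts H. \<exists>a\<in>verts G. matched T (verts G) (verts H) (free_vars \<psi>) (s(x := a)) (s'(x := b)))"
    if m: "matched T (verts G) (verts H) (free_vars \<psi> - {x}) s s'"
      and V: "insert x (vars \<psi>) \<subseteq> X" for \<psi> x s s'
  proof -
    have fin: "finite (free_vars \<psi>)"
      by (rule finite_subset[OF _ X(1)]) (use free_sub[of \<psi>] V in blast)
    \<comment> \<open>The quantified \<open>x\<close> lies in \<open>X\<close> but not in
      \<open>free_vars \<psi> - {x}\<close>. This strict inequality is why \<open>card X\<close> may
      be as large as the number of vertices in \<open>T\<close>.\<close>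
    have "card (free_vars \<psi> - {x}) < card X"
      by (rule psubset_card_mono[OF X(1)]) (use free_sub[of \<psi>] V in blast)
    with X have "card (free_vars \<psi> - {x}) < card (verts H \<inter> T)"
      "card (free_vars \<psi> - {x}) < card (verts G \<inter> T)" by linarith+
    moreover have "verts G - T \<subseteq> verts H" "verts H - T \<subseteq> verts G"
      using out by auto
    \<comment> \<open>Reversing the roles of the graphs yields the answers to moves made in
      \<open>H\<close>.\<close>
    moreover have "matched T (verts H) (verts G) (free_vars \<psi> - {x}) s' s"
      using m by (simp add: matched_sym[of T "verts H"])
    ultimately show ?thesis
      using matched_extend[OF m _ fin] matched_extend[of T "verts H" "verts G", OF _ _ fin]
      unfolding matched_sym[of T "verts H" "verts G"] by (intro conjI ballI) simp_all
  qed
  show ?thesis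
    using assms(6,7)
  proof (induction \<phi> arbitrary: s s')
    case (Eq x y)
    then show ?case by (auto simp: matched_def)
  next
    case (Adj x y)
    then show ?case using adj by simp
  next
    case (Neg \<phi>)
    then show ?case by simp
  next
    case (Conj \<phi> \<psi>)
    from Conj.prems have "matched T (verts G) (verts H) (free_vars \<phi>) s s'"
      "matched T (verts G) (verts H) (free_vars \<psi>) s s'"
      by (auto elim: matched_mono)
    with Conj show ?case by simp
  next
    case (Disj \<phi> \<psi>)
    from Disj.prems have "matched T (verts G) (verts H) (free_vars \<phi>) s s'"
      "matched T (verts G) (verts H) (free_vars \<psi>) s s'"
      by (auto elim: matched_mono)
    with Disj show ?case by simp
  next
    case (Imp \<phi> \<psi>)
    from Imp.prems have "matched T (verts G) (verts H) (free_vars \<phi>) s s'"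
      "matched T (verts G) (verts H) (free_vars \<psi>) s s'"
      by (auto elim: matched_mono)
    with Imp show ?case by simp
  next
    case (Ex x \<phi>)
    have V: "insert x (vars \<phi>) \<subseteq> X" and m: "matched T (verts G) (verts H) (free_vars \<phi> - {x}) s s'"
      using Ex.prems by auto
    show ?case
      using step[OF m V] Ex.IH V by simp meson
  next
    case (All x \<phi>)
    have V: "insert x (vars \<phi>) \<subseteq> X" and m: "matched T (verts G) (verts H) (free_vars \<phi> - {x}) s s'"
      using All.prems by auto
    show ?case
      using step[OF m V] All.IH V by simp meson
  qed
qed

section \<open>Adjacency within and around a twin class\<close>

lemma twin_class_adj:
  assumes "graph G" "T \<in> twin_classes G" "u \<in> T" "v \<in> T" "w \<in> verts G" "w \<noteq> u" "w \<noteq> v"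
  shows "(w \<rightarrow>\<^bsub>G\<^esub> u) = (w \<rightarrow>\<^bsub>G\<^esub> v)"
proof -
  have "(u, v) \<in> twin_rel G"
    using equiv_twin_rel[OF assms(1)] assms(2-4) unfolding twin_classes_def
    by (meson quotient_eq_iff)
  then show ?thesis
    using assms(5-7) by (auto simp: twin_rel_def separates_def)
qed

lemma twin_class_subset:
  assumes "graph G" "T \<in> twin_classes G"
  shows "T \<subseteq> verts G"
  using assms equiv_twin_rel by (metis Union_quotient Union_upper twin_classes_def)

text \<open>A twin class is a clique or an independent set, and an outside vertex is adjacent to all
  of it or to none of it. Hence moving values inside \<open>T\<close> injectively changes no
  adjacency.\<close>

lemma adj_iff_if_matched:
  assumes G: "graph G" and T: "T \<in> twin_classes G"
    and m: "matched T (verts G) (verts G) {x, y} s s'"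
  shows "(s x \<rightarrow>\<^bsub>G\<^esub> s y) = (s' x \<rightarrow>\<^bsub>G\<^esub> s' y)"
proof -
  interpret graph G by fact
  have sym: "(a \<rightarrow>\<^bsub>G\<^esub> b) = (b \<rightarrow>\<^bsub>G\<^esub> a)" for a b
    using sym_arcs by (auto simp: symmetric_def dest: symD)
  have irr: "\<not> a \<rightarrow>\<^bsub>G\<^esub> a" for a
    using adj_not_same by blast
  note tw = twin_class_adj[OF G T]
  \<comment> \<open>Exchange one endpoint at a time: through the pair \<open>a\<close>,
    \<open>d\<close> if they differ, and through \<open>a\<close>, \<open>c\<close> if
    \<open>a = d\<close>.\<close>
  have homog: "(a \<rightarrow>\<^bsub>G\<^esub> b) = (c \<rightarrow>\<^bsub>G\<^esub> d)"
    if "a \<in> T" "b \<in> T" "c \<in> T" "d \<in> T" "a \<noteq> b" "c \<noteq> d" for a b c d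
    using tw sym that twin_class_subset[OF G T] by (metis subsetD)
  have V: "s x \<in> verts G" "s y \<in> verts G" "s' x \<in> verts G" "s' y \<in> verts G"
    and TT: "s x \<in> T \<longleftrightarrow> s' x \<in> T" "s y \<in> T \<longleftrightarrow> s' y \<in> T"
    and fixed: "s x \<notin> T \<Longrightarrow> s' x = s x" "s y \<notin> T \<Longrightarrow> s' y = s y"
    and eq: "s x = s y \<longleftrightarrow> s' x = s' y"
    using m by (auto simp: matched_def)
  show ?thesis
  proof (cases "s x = s y")
    case True
    then show ?thesis using eq irr by metis
  next
    case False
    show ?thesis
    proof (cases "s x \<in> T"; cases "s y \<in> T")
      assume "s x \<in> T" "s y \<in> T"
      then show ?thesis using homog TT False eq by metis
    next
      assume "s x \<in> T" "s y \<notin> T"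
      then show ?thesis using tw[of "s x" "s' x" "s y"] sym TT fixed V by metis
    next
      assume "s x \<notin> T" "s y \<in> T"
      then show ?thesis using tw[of "s y" "s' y" "s x"] TT fixed V by metis
    next
      assume "s x \<notin> T" "s y \<notin> T"
      then show ?thesis using fixed by simp
    qed
  qed
qed

lemma del_vert_adj_iff:
  assumes "a \<noteq> v" "b \<noteq> v"
  shows "(a \<rightarrow>\<^bsub>pre_digraph.del_vert G v\<^esub> b) = (a \<rightarrow>\<^bsub>G\<^esub> b)"
  using assms
  by (auto simp: arcs_ends_def arc_to_ends_def pre_digraph.del_vert_def image_iff)

section \<open>The bound for deleting a twin\<close>

theorem lemma3:
  fixes G :: "('a, 'b) pre_digraph" and T :: "'a set" and t :: nat and v :: 'a
  assumes "graph G"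
    and "T \<in> twin_classes G"
    and "card T = t"
    and "v \<in> T"
  shows "W G (pre_digraph.del_vert G v) \<ge> t"
proof -
  interpret graph G by fact
  let ?H = "pre_digraph.del_vert G v"
  have TV: "T \<subseteq> verts G"
    using twin_class_subset assms by blast
  have vH: "verts ?H = verts G - {v}"
    by (simp add: verts_del_vert)
  have finT: "finite T"
    by (rule finite_subset[OF TV finite_verts])
  have cT: "card (verts G \<inter> T) = t" "card (verts ?H \<inter> T) = t - 1"
  proof -
    have "verts G \<inter> T = T" "verts ?H \<inter> T = T - {v}"
      using TV vH by auto
    then show "card (verts G \<inter> T) = t" "card (verts ?H \<inter> T) = t - 1"
      using assms finT by auto
  qed
  have adj: "(s x \<rightarrow>\<^bsub>G\<^esub> s y) = (s' x \<rightarrow>\<^bsub>?H\<^esub> s' y)"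
    if m: "matched T (verts G) (verts ?H) {x, y} s s'" for s s' :: "nat \<Rightarrow> 'a" and x y
  proof -
    \<comment> \<open>The vertices of \<open>?H\<close> are vertices of \<open>G\<close> other than
      \<open>v\<close>, so adjacency can be compared inside \<open>G\<close> first.\<close>
    have "matched T (verts G) (verts G) {x, y} s s'"
      using m unfolding matched_def vH by blast
    from adj_iff_if_matched[OF assms(1,2) this]
    have "(s x \<rightarrow>\<^bsub>G\<^esub> s y) = (s' x \<rightarrow>\<^bsub>G\<^esub> s' y)" .
    moreover have "s' x \<noteq> v" "s' y \<noteq> v"
      using m unfolding matched_def vH by blast+
    ultimately show ?thesis
      by (simp add: del_vert_adj_iff)
  qed
  have lower: "t \<le> card (vars \<phi>)" if d: "distinguishes \<phi> G ?H" for \<phi>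
  proof (rule ccontr)
    assume less: "\<not> t \<le> card (vars \<phi>)"
    have fin: "finite (vars \<phi>)" by (induction \<phi>) auto
    have sent: "sentence \<phi>" using d by (simp add: distinguishes_def)
    \<comment> \<open>Fewer than \<open>t\<close> variables means at most \<open>t - 1\<close>, the
      number of vertices of \<open>T\<close> left in \<open>?H\<close>. The same \<open>s\<close>
      serves both graphs, as a sentence makes the invariant vacuous.\<close>
    have "sat G s \<phi> = sat ?H s \<phi>" for s
    proof (rule sat_iff_if_matched[OF fin _ _ _ adj order.refl])
      \<comment> \<open>The deleted vertex lies in \<open>T\<close>, so the two graphs have the same
        vertices outside \<open>T\<close>.\<close>
      show "verts G - T = verts ?H - T" using vH assms(4) by auto
      show "matched T (verts G) (verts ?H) (free_vars \<phi>) s s"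
        using sent by (simp add: sentence_def matched_def)
    qed (use less cT in auto)
    then show False using d by (simp add: distinguishes_def models_def)
  qed
  have "v \<in> verts G" using TV assms(4) by blast
  then have "card (verts ?H) < card (verts G)"
    unfolding vH by (intro card_Diff1_less) auto
  then have "\<exists>\<phi>. distinguishes \<phi> G ?H"
    by (intro distinguishes_if_card_verts_less) (auto simp: vH)
  then have "\<exists>n \<phi>. distinguishes \<phi> G ?H \<and> card (vars \<phi>) = n" by blast
  \<comment> \<open>The minimum is attained by an actual sentence, to which \<open>lower\<close>
    applies.\<close>
  from LeastI_ex[OF this] obtain \<phi> where "distinguishes \<phi> G ?H" "card (vars \<phi>) = W G ?H"
    unfolding W_def by blast
  with lower show ?thesis by metis
qed

end
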